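(* Let $\lambda\in\mathbb{C}$ with $\lambda\neq 1$, let $r,k\in\mathbb{Z}$, $s\in\mathbb{Z}_{\geq 0}$ and $n\geq 0$. Then \[ T_{n}^{(r,k)}(x|\lambda)=\sum_{m=0}^{n}\left\{ \binom{n}{m} \sum_{l=0}^{n-m}\frac{\binom{n-m}{l}}{\binom{s+l}{l}}S_{2}(l+s,s)T_{n-m-l}^{(r,k)}(\lambda) \right\} \mathbb{B}^{(s)}_{m}(x). \]
   Context: For $k\in\mathbb{Z}$, $Li_k(x)=\sum_{n\ge1}x^n/n^k$. For $r,k\in\mathbb{Z}$ the polynomials $T_n^{(r,k)}(x|\lambda)$ are defined by $\left(\frac{1-\lambda}{e^t-\lambda}\right)^r\frac{Li_{k}(1-e^{-t})}{1-e^{-t}}e^{xt}=\sum_{n\ge0}T_n^{(r,k)}(x|\lambda)\frac{t^n}{n!}$ (as formal power series in $t$), and $T_n^{(r,k)}(\lambda)=T_n^{(r,k)}(0|\lambda)$. The Bernoulli polynomials of order $s$ are defined by $\left(\frac{t}{e^t-1}\right)^{s}e^{xt}=\sum_{n\ge0}\mathbb{B}_n^{(s)}(x)\frac{t^n}{n!}$. $S_2(l,m)$ denotes the Stirling numbers of the second kind, $(e^t-1)^m=m!\sum_{l\ge m}S_2(l,m)\frac{t^l}{l!}$. *)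

theory Defs
  imports Complex_Main
    "HOL-Computational_Algebra.Formal_Power_Series"
    "HOL-Combinatorics.Stirling"
begin

definition Li_fps :: "int \<Rightarrow> complex fps" where
  "Li_fps k = Abs_fps (\<lambda>n. if n = 0 then 0 else 1 / of_nat n powi k)"

text \<open>
  The polynomials in \<open>x\<close> are represented by their values at complex \<open>x\<close>.
  For \<open>lam \<noteq> 1\<close> the base of the integer power is a unit (constant coefficient 1), and the
  numerator and denominator of the second quotient both have subdegree 1, so all
  quotients of power series below are exact.
\<close>

definition T_gf :: "int \<Rightarrow> int \<Rightarrow> complex \<Rightarrow> complex \<Rightarrow> complex fps" where
  "T_gf r k x lam =
     (fps_const (1 - lam) / (fps_exp 1 - fps_const lam)) powi r
     * (fps_compose (Li_fps k) (1 - fps_exp (-1)) / (1 - fps_exp (-1)))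
     * fps_exp x"

definition T_poly :: "nat \<Rightarrow> int \<Rightarrow> int \<Rightarrow> complex \<Rightarrow> complex \<Rightarrow> complex" where
  "T_poly n r k x lam = fact n * fps_nth (T_gf r k x lam) n"

definition T_num :: "nat \<Rightarrow> int \<Rightarrow> int \<Rightarrow> complex \<Rightarrow> complex" where
  "T_num n r k lam = T_poly n r k 0 lam"

definition bernoulli_gf :: "nat \<Rightarrow> complex \<Rightarrow> complex fps" where
  "bernoulli_gf s x = (fps_X / (fps_exp 1 - 1)) ^ s * fps_exp x"

definition bernoulli_poly :: "nat \<Rightarrow> nat \<Rightarrow> complex \<Rightarrow> complex" where
  "bernoulli_poly s n x = fact n * fps_nth (bernoulli_gf s x) n"

text \<open>
  The library's \<^const>\<open>Stirling\<close> is defined by a recurrence; the following confirms that it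
  has the exponential generating function defining the Stirling numbers of the second kind.
\<close>

lemma Stirling_gf:
  "(fps_exp 1 - 1 :: complex fps) ^ m
     = fps_const (fact m) * Abs_fps (\<lambda>l. of_nat (Stirling l m) / fact l)"
proof -
  define E :: "complex fps" where "E = fps_exp 1 - 1"
  have dE: "fps_deriv (E ^ Suc m) = fps_const (of_nat (Suc m)) * (E ^ Suc m + E ^ m)" for m
  proof -
    have "fps_deriv E = E + 1" by (simp add: E_def)
    then have "fps_deriv (E ^ Suc m) = fps_const (of_nat (Suc m)) * (E + 1) * E ^ m"
      by (simp add: fps_deriv_power del: power_Suc of_nat_Suc)
    then show ?thesis by (simp add: algebra_simps)
  qed
  have rec: "of_nat (Suc n) * fps_nth (E ^ Suc m) (Suc n) = of_nat (Suc m) * (fps_nth (E ^ Suc m) n + fps_nth (E ^ m) n)"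
    for n m
    using arg_cong[OF dE[of m], of "\<lambda>f. fps_nth f n"] by (simp del: power_Suc of_nat_Suc)
  have E0: "fps_nth E 0 = 0" by (simp add: E_def)
  have "fps_nth (E ^ m) n = fact m * of_nat (Stirling n m) / fact n" for n
  proof (induction n arbitrary: m)
    case 0
    show ?case by (cases m) (simp_all add: E0)
  next
    case (Suc n)
    show ?case
    proof (cases m)
      case (Suc j)
      have "of_nat (Suc n) * fps_nth (E ^ Suc j) (Suc n)
              = of_nat (Suc j) * (fact (Suc j) * of_nat (Stirling n (Suc j)) / fact n
                  + fact j * of_nat (Stirling n j) / fact n :: complex)"
        using rec[of n j] unfolding Suc.IH .
      also have "\<dots> = of_nat (Suc n) * (fact (Suc j) * of_nat (Stirling (Suc n) (Suc j)) / fact (Suc n))"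
        by (simp add: field_simps del: of_nat_Suc mult_Suc)
      finally show ?thesis
        unfolding Suc mult_left_cancel[OF of_nat_neq_0] .
    qed simp
  qed
  then show ?thesis
    by (simp add: fps_eq_iff E_def)
qed

end

theory Submission
  imports Defs
begin

text \<open>
  Only the factor \<open>exp (x t)\<close> of the generating function of the polynomials depends on \<open>x\<close>.
  Inserting \<open>1 = ((exp t - 1) / t) ^ s * (t / (exp t - 1)) ^ s\<close> in front of it splits the
  generating function into that of the Bernoulli polynomials of order \<open>s\<close>, that of the numbers
  (the value at \<open>x = 0\<close>), and \<open>((exp t - 1) / t) ^ s\<close>, whose coefficients are Stirling numbers.
\<close>

text \<open>Coefficientwise form of ((exp t - 1) / t) ^ s, which avoids dividing by
  \<open>fps_X ^ s\<close>.\<close>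

definition Stirling_shift_fps :: "nat \<Rightarrow> complex fps" where
  "Stirling_shift_fps s = Abs_fps (\<lambda>l. fact s * of_nat (Stirling (l + s) s) / fact (l + s))"

lemma X_power_times_Stirling_shift_fps:
  "fps_X ^ s * Stirling_shift_fps s = (fps_exp 1 - 1) ^ s"
  \<comment> \<open>Below degree \<open>s\<close> both sides vanish, as
    \<open>Stirling l s = 0\<close> for \<open>l < s\<close>.\<close>
  by (simp add: Stirling_gf Stirling_shift_fps_def fps_eq_iff fps_X_power_mult_nth)

text \<open>The quotient is exact because both series have subdegree 1.\<close>

lemma X_over_exp_minus_1_times:
  "fps_X / (fps_exp 1 - 1) * (fps_exp 1 - 1) = (fps_X :: complex fps)"
proof -
  have sub: "subdegree (fps_exp 1 - 1 :: complex fps) = 1"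
    by (rule subdegreeI) auto
  then have "(fps_exp 1 - 1 :: complex fps) \<noteq> 0"
    by force
  then have "(fps_exp 1 - 1 :: complex fps) dvd fps_X"
    by (subst fps_dvd_iff) (simp_all only: sub, simp_all)
  then show ?thesis
    by (rule dvd_div_mult_self)
qed

lemma Stirling_shift_fps_times_bernoulli_gf:
  "Stirling_shift_fps s * bernoulli_gf s x = fps_exp x"
proof -
  have "fps_X ^ s * (Stirling_shift_fps s * (fps_X / (fps_exp 1 - 1)) ^ s)
      = (fps_X / (fps_exp 1 - 1) * (fps_exp 1 - 1)) ^ s"
    by (simp add: power_mult_distrib mult_ac flip: X_power_times_Stirling_shift_fps)
  also have "\<dots> = fps_X ^ s * 1"
    by (simp add: X_over_exp_minus_1_times)
  finally have "Stirling_shift_fps s * (fps_X / (fps_exp 1 - 1)) ^ s = 1"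
    by (subst (asm) mult_cancel_left) simp
  then show ?thesis
    by (simp add: bernoulli_gf_def flip: mult.assoc)
qed

lemma T_gf_eq_bernoulli_gf_times:
  "T_gf r k x lam = bernoulli_gf s x * (Stirling_shift_fps s * T_gf r k 0 lam)"
proof -
  have "T_gf r k x lam = T_gf r k 0 lam * fps_exp x"
    by (simp add: T_gf_def)
  then show ?thesis
    by (simp add: Stirling_shift_fps_times_bernoulli_gf [of s x, symmetric] mult_ac)
qed

text \<open>The factor \<open>fact l\<close> in both denominators cancels.\<close>

lemma binomial_quotient_eq:
  assumes "l \<le> p"
  shows "of_nat (p choose l) / of_nat ((s + l) choose l)
    = (fact p * fact s / (fact (l + s) * fact (p - l)) :: complex)"
  using assms by (simp add: binomial_fact field_simps)

lemma fact_times_nth_Stirling_shift_fps_mult: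
  "fact p * fps_nth (Stirling_shift_fps s * T_gf r k 0 lam) p =
    (\<Sum>l=0..p. of_nat (p choose l) / of_nat ((s + l) choose l)
       * of_nat (Stirling (l + s) s) * T_num (p - l) r k lam)"
  unfolding fps_mult_nth sum_distrib_left
  by (rule sum.cong)
    (simp_all add: binomial_quotient_eq Stirling_shift_fps_def T_num_def T_poly_def)

theorem theorem7:
  fixes lam x :: complex and r k :: int and s n :: nat
  assumes "lam \<noteq> 1"
  shows "T_poly n r k x lam =
    (\<Sum>m=0..n.
       (of_nat (n choose m) *
          (\<Sum>l=0..n - m.
             of_nat ((n - m) choose l) / of_nat ((s + l) choose l)
             * of_nat (Stirling (l + s) s) * T_num (n - m - l) r k lam))
       * bernoulli_poly s m x)"
  \<comment> \<open>Once the inner sum is folded into a coefficient, a Cauchy product of exponential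
    generating functions remains, whence \<open>n choose m\<close>.\<close>
  unfolding fact_times_nth_Stirling_shift_fps_mult [symmetric]
    T_poly_def T_gf_eq_bernoulli_gf_times [of r k x lam s] fps_mult_nth [of "bernoulli_gf s x"]
    sum_distrib_left
  by (rule sum.cong) (simp_all add: bernoulli_poly_def binomial_fact)

end
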